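(* Let $\tau=\frac{1+\sqrt5}{2}$ and let $\epsilon\in\mathbb{R}$ be such that $A=\tau-\frac{\epsilon}{\tau}>0$ and $B=1+\epsilon>0$. Let $x_m=\left\|\frac{m}{\tau}\right\|A+\left(m-\left\|\frac{m}{\tau}\right\|\right)B$, $m\in\mathbb{Z}$, be the modified Fibonacci chain. Put $a=\frac{\tau+2}{\tau+1}$, $b=\tau a$, $k_0=\frac{2\pi}{a}$, $q_0=\frac{2\pi}{b}$, $u_0=\tau-1-\epsilon\tau$, $v_0=u_0-b$. For integers $n_1,n_2$ let $$K_{n_1,n_2}=n_1k_0+n_2q_0=\frac{2\pi(\tau n_1+n_2)}{\tau a},\qquad w=\frac{n_1k_0u_0+n_2q_0v_0}{2}.$$ Then for all $n_1,n_2\in\mathbb{Z}$ the limit defining the structure factor exists and $$F(K_{n_1,n_2})=\lim_{N\to\infty}\frac1N\sum_{m=1}^{N}\exp(iK_{n_1,n_2}x_m)=\frac{\sin w}{w},$$ where $\frac{\sin w}{w}$ is read as $1$ when $w=0$; hence the normalized intensity at $K_{n_1,n_2}$ is $I=|F(K_{n_1,n_2})|^2=\left(\frac{\sin w}{w}\right)^2$. Moreover, if $u_0\neq0$, then $w=(K_{n_1,n_2}-n_2q_1)\frac{u_0}{2}$ with $q_1=\frac{2\pi\tau}{1-\epsilon\tau^2}$.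
   Context: $\|x\|$ denotes the nearest integer to the real number $x$, with half-integers rounded up: if $m\in\mathbb{Z}$ and $m\le x<m+1$, then $\|x\|=m$ for $x\in[m,m+\frac12)$ and $\|x\|=m+1$ for $x\in[m+\frac12,m+1)$. The points $x_m$ are the positions of atoms of unit scattering power; $A$ and $B$ are the two allowed distances between neighbouring atoms, arranged in a Fibonacci sequence. The structure factor of a sequence $(x_m)$ at $k\in\mathbb{R}$ is $F(k)=\lim_{N\to\infty}\frac1N\sum_{m=1}^N e^{ikx_m}$. *)

theory Defs
  imports "HOL-Analysis.Analysis" "HOL-Probability.Sinc_Integral"
begin

definition tau :: real where
  "tau = (1 + sqrt 5) / 2"

definition dist_A :: "real \<Rightarrow> real" where
  "dist_A \<epsilon> = tau - \<epsilon> / tau"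

definition dist_B :: "real \<Rightarrow> real" where
  "dist_B \<epsilon> = 1 + \<epsilon>"

(* The library function round is the nearest integer with half-integers rounded up:
   round y = floor (y + 1/2). *)
definition fib_chain :: "real \<Rightarrow> int \<Rightarrow> real" where
  "fib_chain \<epsilon> m =
     of_int (round (of_int m / tau)) * dist_A \<epsilon>
     + of_int (m - round (of_int m / tau)) * dist_B \<epsilon>"

definition partial_structure_factor :: "(int \<Rightarrow> real) \<Rightarrow> real \<Rightarrow> nat \<Rightarrow> complex" where
  "partial_structure_factor x k N =
     (1 / of_nat N) * (\<Sum>m=1..N. exp (\<i> * complex_of_real (k * x (int m))))"

(* lim is an unspecified value if the sequence diverges, so convergence is to be
   asserted separately. *)
definition structure_factor :: "(int \<Rightarrow> real) \<Rightarrow> real \<Rightarrow> complex" where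
  "structure_factor x k = lim (partial_structure_factor x k)"

definition intensity :: "(int \<Rightarrow> real) \<Rightarrow> real \<Rightarrow> real" where
  "intensity x k = (cmod (structure_factor x k))\<^sup>2"

definition period_a :: real where
  "period_a = (tau + 2) / (tau + 1)"

definition period_b :: real where
  "period_b = tau * period_a"

definition wave_k0 :: real where
  "wave_k0 = 2 * pi / period_a"

definition wave_q0 :: real where
  "wave_q0 = 2 * pi / period_b"

definition wave_q1 :: "real \<Rightarrow> real" where
  "wave_q1 \<epsilon> = 2 * pi * tau / (1 - \<epsilon> * tau\<^sup>2)"

definition shift_u0 :: "real \<Rightarrow> real" where
  "shift_u0 \<epsilon> = tau - 1 - \<epsilon> * tau"

definition shift_v0 :: "real \<Rightarrow> real" where
  "shift_v0 \<epsilon> = shift_u0 \<epsilon> - period_b"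

definition wave_K :: "int \<Rightarrow> int \<Rightarrow> real" where
  "wave_K n1 n2 = of_int n1 * wave_k0 + of_int n2 * wave_q0"

definition phase_w :: "real \<Rightarrow> int \<Rightarrow> int \<Rightarrow> real" where
  "phase_w \<epsilon> n1 n2 =
     (of_int n1 * wave_k0 * shift_u0 \<epsilon> + of_int n2 * wave_q0 * shift_v0 \<epsilon>) / 2"

end

(* With y_m = m/tau - round (m/tau), the fractional part of 1/2 + m/tau reduced by 1/2, one has
   x_m = m a - y_m u0.  Since m/tau and y_m differ by an integer, K x_m and -2 w y_m agree modulo
   2 pi, so the structure factor is the limiting average of exp (-2 i w y_m), and equidistribution of
   y_m in [-1/2, 1/2) turns it into the integral of exp (-2 i w y), which is sin w / w.

   Equidistribution modulo 1 of c + m theta for irrational theta is elementary: if a = k theta, the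
   indicator of {x} < {a} equals {a} + {x - a} - {x}, so that its sums along the orbit telescope and
   stay within k of N {a}.  The lengths {k theta} are dense in [0, 1], so every interval [0, t] is
   visited with frequency t.  For C^1 functions write f(y) = f(1) - int_y^1 f' and use dominated
   convergence. *)

theory Submission
  imports Defs "HOL-Analysis.Kronecker_Approximation_Theorem"
begin

section \<open>Visit frequencies of an irrational rotation\<close>

lemma of_bool_frac_less_frac:
  fixes x a :: real
  shows "of_bool (frac x < frac a) = frac a + frac (x - a) - frac x"
proof (cases "frac x < frac a")
  case True
  then show ?thesis using frac_diff_neg[of x a] by simp
next
  case False
  then show ?thesis using frac_diff_pos[of a x] by simp
qed

text \<open>Induction on \<open>k\<close>: one further shift by \<open>\<theta>\<close> replaces
  each orbit point by its predecessor, so the extra contribution telescopes to a difference of two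
  fractional parts, of size at most 1.\<close>

lemma abs_sum_frac_shift_le:
  fixes c \<theta> :: real
  shows "\<bar>\<Sum>m=1..N. frac (c + real m * \<theta> - real k * \<theta>) - frac (c + real m * \<theta>)\<bar> \<le> real k"
proof (induction k)
  case 0
  then show ?case by simp
next
  case (Suc k)
  define H where "H j = frac (c + real j * \<theta> - real k * \<theta>)" for j :: nat
  \<comment> \<open>Summation starts at \<open>m = 1\<close>, so the truncated \<open>m - 1\<close>
    is the true predecessor.\<close>
  have shift: "frac (c + real m * \<theta> - real (Suc k) * \<theta>) = H (m - 1)" if "m \<in> {1..N}" for m
    using that by (cases m) (auto simp: H_def algebra_simps)
  have tele: "(\<Sum>m=1..N. H (m - 1) - H m) = H 0 - H N"
    by (induction N) auto
  have "(\<Sum>m=1..N. frac (c + real m * \<theta> - real (Suc k) * \<theta>) - frac (c + real m * \<theta>))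
      = (\<Sum>m=1..N. (H (m - 1) - H m) + (H m - frac (c + real m * \<theta>)))"
    by (intro sum.cong refl) (use shift in auto)
  also have "\<dots> = (H 0 - H N) + (\<Sum>m=1..N. H m - frac (c + real m * \<theta>))"
    by (simp only: sum.distrib tele)
  finally have eq: "(\<Sum>m=1..N. frac (c + real m * \<theta> - real (Suc k) * \<theta>) - frac (c + real m * \<theta>))
      = (H 0 - H N) + (\<Sum>m=1..N. H m - frac (c + real m * \<theta>))" .
  have "\<bar>H 0 - H N\<bar> \<le> 1"
    using frac_ge_0[of "c + real 0 * \<theta> - real k * \<theta>"] frac_lt_1[of "c + real 0 * \<theta> - real k * \<theta>"]
      frac_ge_0[of "c + real N * \<theta> - real k * \<theta>"] frac_lt_1[of "c + real N * \<theta> - real k * \<theta>"]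
    unfolding H_def by linarith
  moreover have "\<bar>\<Sum>m=1..N. H m - frac (c + real m * \<theta>)\<bar> \<le> real k"
    using Suc by (simp add: H_def)
  ultimately show ?case unfolding eq by linarith
qed

text \<open>The bound depends neither on \<open>N\<close> nor on \<open>c\<close>, so it disappears
  after division by \<open>N\<close>.\<close>

lemma frac_rotation_discrepancy:
  fixes c \<theta> :: real
  shows "\<bar>(\<Sum>m=1..N. of_bool (frac (c + real m * \<theta>) < frac (real k * \<theta>))) - real N * frac (real k * \<theta>)\<bar>
    \<le> real k"
proof -
  have "(\<Sum>m=1..N. of_bool (frac (c + real m * \<theta>) < frac (real k * \<theta>))) - real N * frac (real k * \<theta>)
      = (\<Sum>m=1..N. frac (c + real m * \<theta> - real k * \<theta>) - frac (c + real m * \<theta>))"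
    by (simp add: of_bool_frac_less_frac sum.distrib sum_subtractf)
  then show ?thesis
    using abs_sum_frac_shift_le[of c \<theta> k N] by simp
qed

lemma frac_rotation_frequency_multiple:
  fixes c \<theta> :: real
  shows "(\<lambda>N. (\<Sum>m=1..N. of_bool (frac (c + real m * \<theta>) < frac (real k * \<theta>))) / real N)
    \<longlonglongrightarrow> frac (real k * \<theta>)"
proof (rule LIM_zero_cancel, rule Lim_null_comparison)
  show "\<forall>\<^sub>F N in sequentially. norm ((\<Sum>m=1..N. of_bool (frac (c + real m * \<theta>) < frac (real k * \<theta>)))
      / real N - frac (real k * \<theta>)) \<le> real k / real N"
    using eventually_gt_at_top[of 0]
  proof eventually_elim
    case (elim N)
    have "(\<Sum>m=1..N. of_bool (frac (c + real m * \<theta>) < frac (real k * \<theta>))) / real N - frac (real k * \<theta>)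
      = ((\<Sum>m=1..N. of_bool (frac (c + real m * \<theta>) < frac (real k * \<theta>))) - real N * frac (real k * \<theta>)) / real N"
      using elim by (simp add: field_simps)
    then show ?case
      using frac_rotation_discrepancy[of c \<theta> k N] by (simp add: abs_divide divide_right_mono)
  qed
  show "(\<lambda>N. real k / real N) \<longlonglongrightarrow> 0"
    by (rule lim_const_over_n)
qed

text \<open>Kronecker approximation of the midpoint of the interval, with half its length as
  tolerance.\<close>

lemma frac_multiple_between:
  fixes \<theta> :: real
  assumes "\<theta> \<notin> \<rat>" "0 \<le> a" "a < b" "b \<le> 1"
  obtains k where "a < frac (real k * \<theta>)" "frac (real k * \<theta>) < b"
proof -
  obtain k where "\<bar>frac (real k * \<theta>) - (a + b) / 2\<bar> < (b - a) / 2"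
    using Kronecker_approx_1_explicit[of \<theta> "(a + b) / 2" "(b - a) / 2"] assms by auto
  then have "a < frac (real k * \<theta>) \<and> frac (real k * \<theta>) < b"
    by (simp add: abs_if field_simps split: if_splits)
  then show thesis using that by blast
qed

text \<open>Sandwich: the count for \<open>t\<close> lies between the counts for lengths
  \<open>frac (real k * \<theta>)\<close> chosen just below and just above \<open>t\<close>, whose
  frequencies are known.\<close>

lemma frac_rotation_frequency:
  fixes c \<theta> :: real
  assumes irr: "\<theta> \<notin> \<rat>" and t: "0 \<le> t" "t \<le> 1"
  shows "(\<lambda>N. (\<Sum>m=1..N. of_bool (frac (c + real m * \<theta>) \<le> t)) / real N) \<longlonglongrightarrow> t"
proof (rule order_tendstoI)
  let ?L = "\<lambda>k N. (\<Sum>m=1..N. of_bool (frac (c + real m * \<theta>) < frac (real k * \<theta>))) / real N"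
  let ?A = "\<lambda>N. (\<Sum>m=1..N. of_bool (frac (c + real m * \<theta>) \<le> t)) / real N :: real"
  fix l assume l: "l < t"
  show "\<forall>\<^sub>F N in sequentially. l < ?A N"
  \<comment> \<open>Density supplies lengths inside the unit interval only; a negative
    \<open>l\<close> is handled by nonnegativity of the counts, and likewise below some
    \<open>u > 1\<close> by the frequency being at most 1.\<close>
  proof (cases "l < 0")
    case True
    have "0 \<le> ?A N" for N
      by (intro divide_nonneg_nonneg sum_nonneg) auto
    with True show ?thesis
      by (intro always_eventually allI) (meson less_le_trans)
  next
    case False
    then obtain k where k: "l < frac (real k * \<theta>)" "frac (real k * \<theta>) < t"
      using frac_multiple_between[OF irr, of l t] l t by auto
    have le: "?L k N \<le> ?A N" for N
      by (intro divide_right_mono sum_mono) (use k in auto)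
    show ?thesis
      using order_tendstoD(1)[OF frac_rotation_frequency_multiple[of c \<theta> k] k(1)]
      by eventually_elim (use le in \<open>meson less_le_trans\<close>)
  qed
next
  let ?L = "\<lambda>k N. (\<Sum>m=1..N. of_bool (frac (c + real m * \<theta>) < frac (real k * \<theta>))) / real N"
  let ?A = "\<lambda>N. (\<Sum>m=1..N. of_bool (frac (c + real m * \<theta>) \<le> t)) / real N :: real"
  fix u assume u: "t < u"
  show "\<forall>\<^sub>F N in sequentially. ?A N < u"
  proof (cases "1 < u")
    case True
    have "?A N \<le> 1" for N
    proof -
      have "(\<Sum>m=1..N. of_bool (frac (c + real m * \<theta>) \<le> t)) \<le> (\<Sum>m=1..N. 1::real)"
        by (intro sum_mono) auto
      then show ?thesis by (simp add: divide_le_eq)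
    qed
    with True show ?thesis
      by (intro always_eventually allI) (meson le_less_trans)
  next
    case False
    then obtain k where k: "t < frac (real k * \<theta>)" "frac (real k * \<theta>) < u"
      using frac_multiple_between[OF irr, of t u] u t by auto
    have le: "?A N \<le> ?L k N" for N
      by (intro divide_right_mono sum_mono) (use k in auto)
    show ?thesis
      using order_tendstoD(2)[OF frac_rotation_frequency_multiple[of c \<theta> k] k(2)]
      by eventually_elim (use le in \<open>meson le_less_trans\<close>)
  qed
qed

section \<open>From visit frequencies to averages of C^1 functions, and the sinc integral\<close>

lemma equidistribution_C1:
  fixes f f' :: "real \<Rightarrow> 'a::euclidean_space" and u :: "nat \<Rightarrow> real"
  assumes u: "\<And>m. u m \<in> {0..1}"
    and freq: "\<And>t. t \<in> {0..1} \<Longrightarrow> (\<lambda>N. (\<Sum>m=1..N. of_bool (u m \<le> t)) / real N) \<longlonglongrightarrow> t"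
    and deriv: "\<And>t. t \<in> {0..1} \<Longrightarrow> (f has_vector_derivative f' t) (at t within {0..1})"
    and cont: "continuous_on {0..1} f'"
  shows "(\<lambda>N. (\<Sum>m=1..N. f (u m)) /\<^sub>R real N) \<longlonglongrightarrow> integral {0..1} f"
proof -
  \<comment> \<open>The empirical distribution function of the first \<open>N\<close> samples.
    Division by zero makes \<open>D 0 t\<close> equal to 0, so the bounds below hold for every
    \<open>N\<close>.\<close>
  define D where "D N t = (\<Sum>m=1..N. of_bool (u m \<le> t)) / real N" for N t
  have D_bounds: "0 \<le> D N t" "D N t \<le> 1" for N t
  proof -
    show "0 \<le> D N t" unfolding D_def
      by (intro divide_nonneg_nonneg sum_nonneg) auto
    have "(\<Sum>m=1..N. of_bool (u m \<le> t)) \<le> (\<Sum>m=1..N. 1::real)"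
      by (intro sum_mono) auto
    then show "D N t \<le> 1" by (simp add: D_def divide_le_eq)
  qed
  \<comment> \<open>Extending the integral over \<open>{y..1}\<close> by zero moves the dependence
    on \<open>y\<close> into an indicator; averaging over the samples then produces
    \<open>D\<close>.\<close>
  have tail: "((\<lambda>t. of_bool (y \<le> t) *\<^sub>R f' t) has_integral (f 1 - f y)) {0..1}" if y: "y \<in> {0..1}" for y
  proof -
    have "(f' has_integral (f 1 - f y)) {y..1}"
    proof (rule fundamental_theorem_of_calculus)
      show "y \<le> 1" using y by simp
      fix x assume "x \<in> {y..1}"
      then show "(f has_vector_derivative f' x) (at x within {y..1})"
        using y by (intro has_vector_derivative_within_subset[OF deriv]) auto
    qed
    then have "((\<lambda>x. if x \<in> cbox y 1 then f' x else 0) has_integral (f 1 - f y)) (cbox 0 1)"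
      by (intro has_integral_restrict_closed_subinterval) (use y in auto)
    then have "((\<lambda>x. if x \<in> {y..1} then f' x else 0) has_integral (f 1 - f y)) {0..1}"
      by simp
    then show ?thesis
      by (rule has_integral_eq[rotated]) auto
  qed
  have avg: "((\<lambda>t. D N t *\<^sub>R f' t) has_integral (f 1 - (\<Sum>m=1..N. f (u m)) /\<^sub>R real N)) {0..1}"
    if "N > 0" for N
  proof -
    have "((\<lambda>t. (\<Sum>m=1..N. of_bool (u m \<le> t) *\<^sub>R f' t) /\<^sub>R real N) has_integral
        (\<Sum>m=1..N. f 1 - f (u m)) /\<^sub>R real N) {0..1}"
      by (intro has_integral_cmul has_integral_sum tail u) auto
    moreover have "(\<Sum>m=1..N. f 1 - f (u m)) /\<^sub>R real N = f 1 - (\<Sum>m=1..N. f (u m)) /\<^sub>R real N"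
      using that by (simp add: sum_subtractf scaleR_diff_right scaleR_conv_of_real sum_constant_scaleR)
    moreover have "(\<Sum>m=1..N. of_bool (u m \<le> t) *\<^sub>R f' t) /\<^sub>R real N = D N t *\<^sub>R f' t" for t
      by (simp add: D_def scaleR_sum_left[symmetric] divide_inverse mult.commute)
    ultimately show ?thesis by simp
  qed
  \<comment> \<open>The index is \<open>Suc N\<close> because \<open>avg\<close> needs a sample: for
    \<open>N = 0\<close> the integral is 0 while the claimed value is \<open>f 1\<close>. Since
    \<open>D\<close> lies in [0, 1], \<open>norm (f' t)\<close> dominates.\<close>
  have lim: "(\<lambda>N. integral {0..1} (\<lambda>t. D (Suc N) t *\<^sub>R f' t)) \<longlonglongrightarrow> integral {0..1} (\<lambda>t. t *\<^sub>R f' t)"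
  proof (rule dominated_convergence(2))
    show "(\<lambda>t. D (Suc N) t *\<^sub>R f' t) integrable_on {0..1}" for N
      using avg[of "Suc N"] by (auto simp: integrable_on_def)
    show "(\<lambda>t. norm (f' t)) integrable_on {0..1}"
      by (intro integrable_continuous_real continuous_intros cont)
    show "norm (D (Suc N) t *\<^sub>R f' t) \<le> norm (f' t)" for N t
      using D_bounds[of "Suc N" t] by (simp add: mult_left_le_one_le)
    show "(\<lambda>N. D (Suc N) t *\<^sub>R f' t) \<longlonglongrightarrow> t *\<^sub>R f' t" if "t \<in> {0..1}" for t
      using freq[OF that] unfolding D_def[symmetric]
      by (intro tendsto_intros) (rule LIMSEQ_Suc)
  qed
  \<comment> \<open>Integration by parts through the antiderivative \<open>t *\<^sub>R f t\<close>:
    it identifies the limit \<open>f 1\<close> minus the integral of \<open>t *\<^sub>R f' t\<close>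
    as the integral of \<open>f\<close>.\<close>
  have "((\<lambda>t. t *\<^sub>R f' t + 1 *\<^sub>R f t) has_integral (1 *\<^sub>R f 1 - 0 *\<^sub>R f 0)) {0..1}"
    by (rule fundamental_theorem_of_calculus[where f = "\<lambda>t. t *\<^sub>R f t"])
       (auto intro!: derivative_eq_intros deriv)
  then have sum_int: "((\<lambda>t. t *\<^sub>R f' t + f t) has_integral f 1) {0..1}"
    by simp
  have contf: "continuous_on {0..1} f"
    using deriv by (meson continuous_on_eq_continuous_within has_vector_derivative_continuous)
  have "integral {0..1} (\<lambda>t. t *\<^sub>R f' t) + integral {0..1} f = f 1"
    using integral_unique[OF sum_int]
    by (subst (asm) integral_add)
       (auto intro!: integrable_continuous_real continuous_intros cont contf)
  then have int: "integral {0..1} f = f 1 - integral {0..1} (\<lambda>t. t *\<^sub>R f' t)"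
    by (simp add: algebra_simps)
  have "(\<lambda>N. (\<Sum>m=1..Suc N. f (u m)) /\<^sub>R real (Suc N)) \<longlonglongrightarrow> integral {0..1} f"
  proof -
    have "(\<Sum>m=1..Suc N. f (u m)) /\<^sub>R real (Suc N) = f 1 - integral {0..1} (\<lambda>t. D (Suc N) t *\<^sub>R f' t)" for N
      using integral_unique[OF avg[of "Suc N"]] by simp
    then show ?thesis
      unfolding int by (simp only:) (intro tendsto_intros lim)
  qed
  then show ?thesis by (rule LIMSEQ_imp_Suc)
qed

text \<open>The interval is symmetric about 1/2, so at its two ends the cosine terms of the
  antiderivative cancel and the sine terms add up to \<open>sin w / w\<close>. The case
  \<open>w = 0\<close> is the value \<open>sinc 0 = 1\<close>.\<close>

lemma integral_exp_centered_eq_sinc: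
  "integral {0..1} (\<lambda>t. exp (\<i> * complex_of_real (- 2 * w * (t - 1/2)))) = complex_of_real (sinc w)"
proof (cases "w = 0")
  case True
  then show ?thesis by simp
next
  case False
  \<comment> \<open>This is \<open>\<i> / (2 * w)\<close> times the integrand, split into real and
    imaginary parts.\<close>
  let ?F = "\<lambda>t. complex_of_real (sin (2 * w * (t - 1/2)) / (2 * w))
    + \<i> * complex_of_real (cos (2 * w * (t - 1/2)) / (2 * w))"
  have "((\<lambda>t. complex_of_real (cos (2 * w * (t - 1/2))) + \<i> * complex_of_real (- sin (2 * w * (t - 1/2))))
      has_integral (?F 1 - ?F 0)) {0..1}"
    by (rule fundamental_theorem_of_calculus)
       (use False in \<open>auto intro!: derivative_eq_intros simp: field_simps\<close>)
  moreover have "?F 1 - ?F 0 = complex_of_real (sinc w)"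
    using False by (simp add: field_simps)
  moreover have "exp (\<i> * complex_of_real (- 2 * w * (t - 1/2)))
      = complex_of_real (cos (2 * w * (t - 1/2))) + \<i> * complex_of_real (- sin (2 * w * (t - 1/2)))" for t
    by (subst cis_conv_exp[symmetric]) (simp add: complex_eq_iff)
  ultimately show ?thesis
    by (simp only: integral_unique)
qed

section \<open>Arithmetic of the golden ratio\<close>

lemma tau_pos: "tau > 0"
  by (simp add: tau_def add_pos_nonneg)

lemma tau_squared: "tau\<^sup>2 = tau + 1"
  by (simp add: tau_def field_simps power2_eq_square)

lemma inverse_tau: "1 / tau = tau - 1"
  using tau_pos tau_squared by (simp add: field_simps power2_eq_square)

text \<open>Otherwise \<open>sqrt 5 = 2 / tau + 1\<close> would be a rational algebraic integer,
  hence an integer, yet it lies strictly between 2 and 3.\<close>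

lemma inverse_tau_irrational: "1 / tau \<notin> \<rat>"
proof
  assume "1 / tau \<in> \<rat>"
  then have "2 * (1 / tau) + 1 \<in> \<rat>" by (intro Rats_add Rats_mult) auto
  moreover have "2 * (1 / tau) + 1 = sqrt 5"
    unfolding inverse_tau by (simp add: tau_def field_simps)
  ultimately have "sqrt 5 \<in> \<rat>" by simp
  then have "sqrt 5 \<in> \<int>" by (intro rational_algebraic_int_is_int algebraic_int_sqrt) auto
  then obtain n where n: "sqrt 5 = of_int n" by (auto elim: Ints_cases)
  have "sqrt 5 > sqrt (2\<^sup>2)" "sqrt 5 < sqrt (3\<^sup>2)"
    by (intro real_sqrt_less_mono; simp)+
  then have "2 < n" "n < 3" unfolding n real_sqrt_abs by auto
  then show False by simp
qed

section \<open>The chain as a modulated lattice, and its phases\<close>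

lemma period_a_eq: "period_a = 1 + 1 / tau\<^sup>2"
  using tau_pos by (simp add: period_a_def tau_squared field_simps)

lemma period_a_pos: "period_a > 0"
  using tau_pos by (simp add: period_a_def)

text \<open>A lattice of mean spacing \<open>period_a\<close> with a bounded sawtooth modulation.
  Rounding is the floor after adding 1/2, which puts the offset 1/2 inside \<open>frac\<close>. With
  \<open>r\<close> the rounded value, the position is \<open>m\<close> times
  \<open>dist_B \<epsilon>\<close> plus \<open>r\<close> times
  \<open>shift_u0 \<epsilon>\<close>.\<close>

lemma fib_chain_eq:
  "fib_chain \<epsilon> m = of_int m * period_a - (frac (1/2 + of_int m * (1 / tau)) - 1/2) * shift_u0 \<epsilon>"
proof -
  define r where "r = real_of_int (round (of_int m / tau))"
  have frac: "frac (1/2 + of_int m * (1 / tau)) - 1/2 = of_int m * (1 / tau) - r"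
    by (simp add: r_def frac_def round_def add.commute)
  have AB: "dist_A \<epsilon> - dist_B \<epsilon> = shift_u0 \<epsilon>"
  proof -
    have "\<epsilon> / tau = \<epsilon> * (tau - 1)" by (simp flip: inverse_tau)
    then show ?thesis by (simp add: dist_A_def dist_B_def shift_u0_def algebra_simps)
  qed
  \<comment> \<open>The mean spacing does not depend on \<open>\<epsilon>\<close>: its coefficient
    is \<open>1 - (tau\<^sup>2 - tau)\<close>, which is 0.\<close>
  have a: "dist_B \<epsilon> + (1 / tau) * shift_u0 \<epsilon> = period_a"
  proof -
    have "period_a = 1 + (tau - 1) * (tau - 1)"
      unfolding inverse_tau[symmetric] by (simp add: period_a_eq power2_eq_square)
    moreover have "tau * tau = tau + 1" using tau_squared by (simp add: power2_eq_square)
    moreover have "(tau - 1) * shift_u0 \<epsilon> = (tau - 1) * (tau - 1) - \<epsilon> * (tau * tau - tau)"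
      by (simp add: shift_u0_def algebra_simps)
    ultimately show ?thesis by (simp add: dist_B_def inverse_tau)
  qed
  have "fib_chain \<epsilon> m = of_int m * dist_B \<epsilon> + r * shift_u0 \<epsilon>"
    by (simp add: fib_chain_def r_def AB[symmetric] algebra_simps)
  also have "\<dots> = of_int m * period_a - (of_int m * (1 / tau) - r) * shift_u0 \<epsilon>"
    by (simp add: a[symmetric] algebra_simps)
  finally show ?thesis by (simp only: frac)
qed

lemma wave_K_eq: "wave_K n1 n2 = 2 * pi * (tau * of_int n1 + of_int n2) / (tau * period_a)"
  using tau_pos period_a_pos
  by (simp add: wave_K_def wave_k0_def wave_q0_def period_b_def field_simps)

text \<open>Substituting \<open>shift_v0 \<epsilon> = shift_u0 \<epsilon> - period_b\<close> splits
  off \<open>2 * pi * n2\<close>, because \<open>wave_q0 * period_b\<close> is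
  \<open>2 * pi\<close>.\<close>

lemma phase_w_eq: "2 * phase_w \<epsilon> n1 n2 = wave_K n1 n2 * shift_u0 \<epsilon> - 2 * pi * of_int n2"
  using tau_pos period_a_pos
  by (simp add: phase_w_def wave_K_def shift_v0_def wave_q0_def period_b_def field_simps)

lemma exp_wave_K_fib_chain:
  "exp (\<i> * complex_of_real (wave_K n1 n2 * fib_chain \<epsilon> m))
    = exp (\<i> * complex_of_real (- 2 * phase_w \<epsilon> n1 n2 * (frac (1/2 + of_int m * (1 / tau)) - 1/2)))"
proof -
  define y where "y = frac (1/2 + of_int m * (1 / tau)) - 1/2"
  define r where "r = \<lfloor>1/2 + of_int m * (1 / tau)\<rfloor>"
  have yr: "of_int m * (1 / tau) = y + of_int r"
    by (simp add: y_def r_def frac_def)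
  \<comment> \<open>Over \<open>m\<close> mean spacings the phase is a multiple of
    \<open>2 * pi\<close> plus \<open>2 * pi * n2\<close> times \<open>m / tau\<close>, and
    \<open>m / tau\<close> is \<open>y\<close> up to the integer \<open>r\<close>.\<close>
  have "wave_K n1 n2 * period_a = 2 * pi * (of_int n1 + of_int n2 * (1 / tau))"
    using tau_pos period_a_pos by (simp add: wave_K_eq field_simps)
  then have "of_int m * (wave_K n1 n2 * period_a) = of_int m * (2 * pi * (of_int n1 + of_int n2 * (1 / tau)))"
    by simp
  then have "wave_K n1 n2 * (of_int m * period_a)
      = 2 * pi * (of_int n1 * of_int m + of_int n2 * (of_int m * (1 / tau)))"
    by (simp add: algebra_simps)
  moreover have "fib_chain \<epsilon> m = of_int m * period_a - y * shift_u0 \<epsilon>"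
    by (simp only: fib_chain_eq y_def)
  ultimately have "wave_K n1 n2 * fib_chain \<epsilon> m
      = 2 * pi * (of_int n1 * of_int m + of_int n2 * (y + of_int r)) - wave_K n1 n2 * shift_u0 \<epsilon> * y"
    unfolding yr by (simp only: right_diff_distrib) (simp only: mult_ac)
  \<comment> \<open>The leftover \<open>2 * pi * n2 * y\<close> joins the modulation term; by
    \<open>phase_w_eq\<close> they make \<open>- 2 * phase_w \<epsilon> n1 n2 * y\<close>, and what
    remains is an integer multiple of \<open>2 * pi\<close>.\<close>
  also have "\<dots> = - 2 * phase_w \<epsilon> n1 n2 * y + 2 * pi * of_int (n1 * m + n2 * r)"
  proof -
    have "- 2 * phase_w \<epsilon> n1 n2 * y = - (wave_K n1 n2 * shift_u0 \<epsilon> - 2 * pi * of_int n2) * y"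
      unfolding phase_w_eq[symmetric] by simp
    then show ?thesis by (simp only: of_int_add of_int_mult) (simp add: algebra_simps)
  qed
  finally have eq: "wave_K n1 n2 * fib_chain \<epsilon> m
      = - 2 * phase_w \<epsilon> n1 n2 * y + 2 * pi * of_int (n1 * m + n2 * r)" .
  have "cis (wave_K n1 n2 * fib_chain \<epsilon> m) = cis (- 2 * phase_w \<epsilon> n1 n2 * y)"
    by (simp only: eq cis_mult[symmetric] cis_multiple_2pi[OF Ints_of_int] mult_1_right)
  then show ?thesis by (simp only: cis_conv_exp y_def)
qed

section \<open>The structure factor as a limiting average\<close>

lemma partial_structure_factor_tendsto:
  "partial_structure_factor (fib_chain \<epsilon>) (wave_K n1 n2) \<longlonglongrightarrow> complex_of_real (sinc (phase_w \<epsilon> n1 n2))"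
proof -
  define w where "w = phase_w \<epsilon> n1 n2"
  define f where "f t = exp (\<i> * complex_of_real (- 2 * w * (t - 1/2)))" for t
  define f' where "f' t = \<i> * complex_of_real (- 2 * w) * f t" for t
  define u where "u m = frac (1/2 + real m * (1 / tau))" for m
  have "(\<lambda>N. (\<Sum>m=1..N. f (u m)) /\<^sub>R real N) \<longlonglongrightarrow> integral {0..1} f"
  proof (rule equidistribution_C1)
    show "u m \<in> {0..1}" for m
      using frac_lt_1[of "1/2 + real m * (1 / tau)"] by (simp add: u_def less_imp_le)
    show "(\<lambda>N. (\<Sum>m=1..N. of_bool (u m \<le> t)) / real N) \<longlonglongrightarrow> t" if "t \<in> {0..1}" for t
      using frac_rotation_frequency[OF inverse_tau_irrational] that unfolding u_def by simp
    show "(f has_vector_derivative f' t) (at t within {0..1})" for t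
    proof -
      \<comment> \<open>Differentiation takes place in a complex variable, and the result is then
        restricted to the real segment.\<close>
      have "((\<lambda>z. exp (\<i> * (- 2 * of_real w * (z - 1/2)))) has_field_derivative f' t) (at (complex_of_real t))"
        unfolding f_def f'_def by (auto intro!: derivative_eq_intros)
      from has_vector_derivative_real_field[OF this, of "{0..1}"] show ?thesis
        by (simp add: f_def[abs_def])
    qed
    show "continuous_on {0..1} f'"
      unfolding f_def f'_def by (intro continuous_intros)
  qed
  moreover have "integral {0..1} f = complex_of_real (sinc w)"
    unfolding f_def by (rule integral_exp_centered_eq_sinc)
  moreover have "partial_structure_factor (fib_chain \<epsilon>) (wave_K n1 n2)
      = (\<lambda>N. (\<Sum>m=1..N. f (u m)) /\<^sub>R real N)"
    by (rule ext)
      (simp only: partial_structure_factor_def exp_wave_K_fib_chain f_def u_def w_def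
        scaleR_conv_of_real of_real_inverse of_real_of_nat_eq
        inverse_eq_divide of_real_divide of_real_1 of_int_of_nat_eq)
  ultimately show ?thesis by (simp only: w_def)
qed

text \<open>Since \<open>tau * shift_u0 \<epsilon>\<close> is the denominator in
  \<open>wave_q1 \<epsilon>\<close>, the latter is \<open>2 * pi / shift_u0 \<epsilon>\<close>, and
  the term \<open>2 * pi * n2\<close> of \<open>phase_w_eq\<close> can be absorbed into the wave
  number.\<close>

lemma phase_w_eq_wave_q1:
  assumes "shift_u0 \<epsilon> \<noteq> 0"
  shows "phase_w \<epsilon> n1 n2 = (wave_K n1 n2 - of_int n2 * wave_q1 \<epsilon>) * shift_u0 \<epsilon> / 2"
proof -
  have "tau * shift_u0 \<epsilon> = 1 - \<epsilon> * tau\<^sup>2"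
  proof -
    have "tau * shift_u0 \<epsilon> = tau\<^sup>2 - tau - \<epsilon> * tau\<^sup>2"
      by (simp add: shift_u0_def algebra_simps power2_eq_square)
    then show ?thesis by (simp add: tau_squared)
  qed
  then have "wave_q1 \<epsilon> * shift_u0 \<epsilon> = 2 * pi"
    using assms tau_pos by (simp add: wave_q1_def flip: \<open>tau * shift_u0 \<epsilon> = 1 - \<epsilon> * tau\<^sup>2\<close>)
  then have "(wave_K n1 n2 - of_int n2 * wave_q1 \<epsilon>) * shift_u0 \<epsilon> = 2 * phase_w \<epsilon> n1 n2"
    by (simp only: phase_w_eq left_diff_distrib mult.assoc) (simp only: mult_ac)
  then show ?thesis by simp
qed

theorem mainTheorem1:
  fixes \<epsilon> :: real
  assumes "dist_A \<epsilon> > 0" and "dist_B \<epsilon> > 0"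
  shows "\<forall>n1 n2 :: int.
      wave_K n1 n2 = 2 * pi * (tau * of_int n1 + of_int n2) / (tau * period_a)
    \<and> partial_structure_factor (fib_chain \<epsilon>) (wave_K n1 n2)
        \<longlonglongrightarrow> complex_of_real (sinc (phase_w \<epsilon> n1 n2))
    \<and> structure_factor (fib_chain \<epsilon>) (wave_K n1 n2)
        = complex_of_real (sinc (phase_w \<epsilon> n1 n2))
    \<and> intensity (fib_chain \<epsilon>) (wave_K n1 n2) = (sinc (phase_w \<epsilon> n1 n2))\<^sup>2
    \<and> (shift_u0 \<epsilon> \<noteq> 0 \<longrightarrow>
         phase_w \<epsilon> n1 n2 = (wave_K n1 n2 - of_int n2 * wave_q1 \<epsilon>) * shift_u0 \<epsilon> / 2)"
proof (intro allI conjI impI)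
  fix n1 n2 :: int
  show "wave_K n1 n2 = 2 * pi * (tau * of_int n1 + of_int n2) / (tau * period_a)"
    by (rule wave_K_eq)
  show "partial_structure_factor (fib_chain \<epsilon>) (wave_K n1 n2)
      \<longlonglongrightarrow> complex_of_real (sinc (phase_w \<epsilon> n1 n2))"
    by (rule partial_structure_factor_tendsto)
  \<comment> \<open>Convergence is what identifies \<open>lim\<close> with the value found.\<close>
  then show F: "structure_factor (fib_chain \<epsilon>) (wave_K n1 n2)
      = complex_of_real (sinc (phase_w \<epsilon> n1 n2))"
    unfolding structure_factor_def by (rule limI)
  show "intensity (fib_chain \<epsilon>) (wave_K n1 n2) = (sinc (phase_w \<epsilon> n1 n2))\<^sup>2"
    unfolding intensity_def F norm_of_real by (rule power2_abs)
  show "phase_w \<epsilon> n1 n2 = (wave_K n1 n2 - of_int n2 * wave_q1 \<epsilon>) * shift_u0 \<epsilon> / 2"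
    if "shift_u0 \<epsilon> \<noteq> 0"
    using that by (rule phase_w_eq_wave_q1)
qed

end
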